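(* Let $0<p<\infty$. Then the following hold. (i) The set $(\ell^{\infty}\setminus \ell^p)\cup \{0\}$ is maximal dense-lineable in $\ell^\infty$. (ii) If $\ell^{\infty}$ is endowed with the coordinatewise product, the set $(\ell^{\infty}\setminus \ell^p)\cup \{0\}$ is densely strongly $\mathfrak{c}$-algebrable in $\ell^\infty$.
   Context: $\ell^{\infty}$ is the real Banach space of bounded real sequences (indexed by $\mathbb{N}$) with the uniform norm; $\ell^p$ is the set of real sequences $(x_n)$ with $\sum_n |x_n|^p<\infty$; $\mathfrak{c}$ is the cardinality of the continuum. A subset $M$ of a topological vector space $X$ is called maximal dense-lineable if $M\cup\{0\}$ contains a dense linear subspace of $X$ of dimension $\dim(X)$, where $\dim$ denotes algebraic (Hamel) dimension. A subset $M$ of a Banach algebra $X$ is called densely strongly $\mathfrak{c}$-algebrable if $M\cup\{0\}$ contains a dense subalgebra of $X$ generated by an algebraically independent set of cardinality $\mathfrak{c}$. Subalgebras are not required to contain the unit: the algebra generated by a set $G$ is the linear span of all products $g_1^{n_1}\cdots g_k^{n_k}$ with $k,n_1,\dots,n_k\geq 1$ and $g_1,\dots,g_k\in G$. A set $G$ is algebraically independent if for every $k\ge 1$, every non-zero polynomial $P\in\mathbb{R}[x_1,\dots,x_k]$ with $P(0)=0$, and all pairwise distinct $g_1,\dots,g_k\in G$, one has $P(g_1,\dots,g_k)\neq 0$. *)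

theory Defs
  imports
    "HOL-Analysis.Analysis"
    "HOL-Library.Equipollence"
    "HOL-Library.Poly_Mapping"
begin

section \<open>The Banach algebra of bounded sequences\<close>

text \<open>
  Since \<^typ>\<open>nat\<close> is discrete, the bounded continuous functions on it are exactly the bounded
  sequences (see \<open>bcontfun_nat_iff\<close>), and the library norm on them is the supremum norm.
\<close>

type_synonym ell_infinity = "nat \<Rightarrow>\<^sub>C real"

lemma bcontfun_nat_iff: "(x :: nat \<Rightarrow> real) \<in> bcontfun \<longleftrightarrow> bounded (range x)"
  by (simp add: bcontfun_def)

text \<open>
  The library proves completeness only over a metric domain, and \<^typ>\<open>nat\<close> is not
  an instance of \<^class>\<open>metric_space\<close>.
\<close>

instance bcontfun :: (topological_space, complete_space) complete_space
proof
  fix X :: "nat \<Rightarrow> 'a \<Rightarrow>\<^sub>C 'b"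
  assume X: "Cauchy X"
  have "uniformly_Cauchy_on UNIV (\<lambda>n. apply_bcontfun (X n))"
    unfolding uniformly_Cauchy_on_def
    using X by (meson Cauchy_def dist_fun_lt_imp_dist_val_lt)
  then obtain l where "uniform_limit UNIV (\<lambda>n. apply_bcontfun (X n)) l sequentially"
    using Cauchy_uniformly_convergent uniformly_convergent_on_def by blast
  then obtain l' where "X \<longlonglongrightarrow> l'"
    by (rule uniform_limit_bcontfunE) simp_all
  then show "convergent X" by (rule convergentI)
qed

instance bcontfun :: (topological_space, banach) banach ..

text \<open>
  The library has no product on bounded continuous functions; the one below is pointwise.
\<close>

instantiation bcontfun :: (topological_space, real_normed_algebra_1) real_normed_algebra_1
begin

lemma times_cont:
  fixes f g :: "'a \<Rightarrow> 'b"
  assumes "f \<in> bcontfun" "g \<in> bcontfun"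
  shows "(\<lambda>x. f x * g x) \<in> bcontfun"
proof -
  obtain a where a: "\<And>x. norm (f x) \<le> a"
    using assms(1) by (auto simp: bcontfun_def bounded_iff)
  obtain b where b: "\<And>x. norm (g x) \<le> b"
    using assms(2) by (auto simp: bcontfun_def bounded_iff)
  have "norm (f x * g x) \<le> a * b" for x
  proof -
    have "0 \<le> a" using norm_ge_zero a by (rule order_trans)
    have "norm (f x * g x) \<le> norm (f x) * norm (g x)" by (rule norm_mult_ineq)
    also have "\<dots> \<le> a * b" using a b \<open>0 \<le> a\<close> by (intro mult_mono) auto
    finally show ?thesis .
  qed
  moreover have "continuous_on UNIV (\<lambda>x. f x * g x)"
    using assms by (auto simp: bcontfun_def intro!: continuous_intros)
  ultimately show ?thesis by (intro bcontfun_normI)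
qed

definition times_bcontfun :: "('a \<Rightarrow>\<^sub>C 'b) \<Rightarrow> ('a \<Rightarrow>\<^sub>C 'b) \<Rightarrow> 'a \<Rightarrow>\<^sub>C 'b"
  where "f * g = Bcontfun (\<lambda>x. apply_bcontfun f x * apply_bcontfun g x)"

definition one_bcontfun :: "'a \<Rightarrow>\<^sub>C 'b"
  where "1 = const_bcontfun 1"

lemma apply_bcontfun_times [simp]:
  "apply_bcontfun (f * g) x = apply_bcontfun f x * apply_bcontfun g x"
  by (simp add: times_bcontfun_def Bcontfun_inverse times_cont apply_bcontfun)

lemma apply_bcontfun_one [simp]: "apply_bcontfun 1 x = 1"
  by (simp add: one_bcontfun_def)

instance
proof
  fix f g :: "'a \<Rightarrow>\<^sub>C 'b"
  show "norm (f * g) \<le> norm f * norm g"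
  proof (rule norm_bound)
    fix x
    have "norm (apply_bcontfun (f * g) x) \<le> norm (apply_bcontfun f x) * norm (apply_bcontfun g x)"
      by (simp add: norm_mult_ineq)
    also have "\<dots> \<le> norm f * norm g"
      by (intro mult_mono norm_bounded) auto
    finally show "norm (apply_bcontfun (f * g) x) \<le> norm f * norm g" .
  qed
  show "norm (1 :: 'a \<Rightarrow>\<^sub>C 'b) = 1"
  proof (rule antisym)
    show "norm (1 :: 'a \<Rightarrow>\<^sub>C 'b) \<le> 1" by (rule norm_bound) simp
    show "1 \<le> norm (1 :: 'a \<Rightarrow>\<^sub>C 'b)"
      using norm_bounded[of "1 :: 'a \<Rightarrow>\<^sub>C 'b" undefined] by simp
  qed
  have "apply_bcontfun (0 :: 'a \<Rightarrow>\<^sub>C 'b) undefined \<noteq> apply_bcontfun 1 undefined"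
    by simp
  then show "(0 :: 'a \<Rightarrow>\<^sub>C 'b) \<noteq> 1" by metis
qed (auto intro!: bcontfun_eqI simp: algebra_simps)

end

instance bcontfun :: (topological_space, "{real_normed_algebra_1, comm_ring_1}") comm_ring_1
  by standard (auto intro!: bcontfun_eqI simp: algebra_simps)

text \<open>
  For \<open>p > 0\<close> we have \<open>0 powr p = 0\<close>, so \<open>powr\<close> is the intended power at zero entries too.
\<close>

definition ell_p :: "real \<Rightarrow> (nat \<Rightarrow> real) set" where
  "ell_p p = {x. summable (\<lambda>n. \<bar>x n\<bar> powr p)}"


section \<open>Lineability\<close>

text \<open>
  The library constant \<^const>\<open>dim\<close> is a natural number, with value 0 for every infinite-dimensional
  space, so equality of Hamel dimensions is expressed by equipollent bases.
\<close>

definition hamel_basis :: "'a::real_vector set \<Rightarrow> 'a set \<Rightarrow> bool" where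
  "hamel_basis V B \<longleftrightarrow> independent B \<and> span B = V"

definition same_hamel_dim :: "'a::real_vector set \<Rightarrow> 'b::real_vector set \<Rightarrow> bool" where
  "same_hamel_dim V W \<longleftrightarrow> (\<exists>B C. hamel_basis V B \<and> hamel_basis W C \<and> B \<approx> C)"

definition maximal_dense_lineable :: "'a::{real_vector, topological_space} set \<Rightarrow> bool" where
  "maximal_dense_lineable M \<longleftrightarrow>
     (\<exists>W. subspace W \<and> W \<subseteq> M \<union> {0} \<and> closure W = UNIV \<and> same_hamel_dim W (UNIV :: 'a set))"


section \<open>Algebrability\<close>

text \<open>
  A real polynomial in the variables \<open>x\<^sub>0, x\<^sub>1, \<dots>\<close> is a finitely supported map from
  monomials to coefficients; a monomial is a finitely supported map from variables to exponents.
\<close>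

type_synonym real_mpoly = "(nat \<Rightarrow>\<^sub>0 nat) \<Rightarrow>\<^sub>0 real"

definition mpoly_vars :: "real_mpoly \<Rightarrow> nat set" where
  "mpoly_vars P = (\<Union>m\<in>Poly_Mapping.keys P. Poly_Mapping.keys m)"

definition mpoly_eval ::
  "real_mpoly \<Rightarrow> (nat \<Rightarrow> 'a) \<Rightarrow> 'a::{real_normed_algebra_1, comm_ring_1}" where
  "mpoly_eval P g = (\<Sum>m\<in>Poly_Mapping.keys P. Poly_Mapping.lookup P m *\<^sub>R (\<Prod>i\<in>Poly_Mapping.keys m. g i ^ Poly_Mapping.lookup m i))"

definition algebraically_independent :: "'a::{real_normed_algebra_1, comm_ring_1} set \<Rightarrow> bool" where
  "algebraically_independent G \<longleftrightarrow>
     (\<forall>k\<ge>1. \<forall>P g. P \<noteq> 0 \<longrightarrow> mpoly_vars P \<subseteq> {..<k} \<longrightarrow> mpoly_eval P (\<lambda>_. 0 :: real) = 0 \<longrightarrow>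
        g ` {..<k} \<subseteq> G \<longrightarrow> inj_on g {..<k} \<longrightarrow> mpoly_eval P g \<noteq> 0)"

text \<open>Subalgebras need not contain the unit, hence at least one factor and positive exponents.\<close>

definition generated_algebra :: "'a::{real_normed_algebra_1, comm_ring_1} set \<Rightarrow> 'a set" where
  "generated_algebra G =
     span {\<Prod>i<k. g i ^ n i | (k::nat) (g :: nat \<Rightarrow> 'a) (n :: nat \<Rightarrow> nat).
             k \<ge> 1 \<and> (\<forall>i<k. g i \<in> G \<and> n i \<ge> 1)}"

definition densely_strongly_continuum_algebrable ::
  "'a::{banach, real_normed_algebra_1, comm_ring_1} set \<Rightarrow> bool" where
  "densely_strongly_continuum_algebrable M \<longleftrightarrow>
     (\<exists>G. G \<approx> (UNIV :: real set) \<and> algebraically_independent G \<and>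
          generated_algebra G \<subseteq> M \<union> {0} \<and> closure (generated_algebra G) = UNIV)"

end

theory Submission
  imports Defs
begin

text \<open>
  Enumerate the pairs \<open>(d, m)\<close>, with \<open>d\<close> a sequence of finite range and \<open>m\<close> a natural number, by
  the sets \<open>A\<close> of natural numbers, and perturb: the generators are \<open>d\<^sub>A + h\<^sub>A / (m\<^sub>A + 1)\<close>, where the
  sequences \<open>h\<^sub>A\<close> take values \<open>1 / (v + 1)\<close> and are independent, in the sense that finitely many of
  them attain any prescribed combination of such values simultaneously at infinitely many places.
  The generators alone are already dense. A non-zero polynomial, shifted by each of the finitely
  many vectors attained by the sequences \<open>d\<^sub>A\<close> involved, is non-zero at some grid point that serves
  all shifts at once; hence its value at the generators stays away from zero infinitely often and
  is not in \<open>ell_p p\<close>. So the generators are algebraically independent and generate an algebra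
  meeting \<open>ell_p p\<close> only in zero, and this algebra also witnesses maximal dense-lineability.
\<close>

section \<open>Polynomials on grids\<close>

text \<open>Induction on the variables: seen from one variable \<open>j\<close>, the sum is a
  polynomial whose coefficients involve the remaining variables. The induction hypothesis keeps one
  coefficient non-zero for all shifts in \<open>S\<close>, after which each shift rules out only
  finitely many values for \<open>j\<close>.\<close>

lemma exists_grid_point_nonzero:
  fixes e :: "'m \<Rightarrow> 'j \<Rightarrow> nat" and a :: "'m \<Rightarrow> 'a::idom"
  assumes "finite J" "finite F" "F \<noteq> {}" "\<And>m. m \<in> F \<Longrightarrow> a m \<noteq> 0"
    and "\<And>m m'. m \<in> F \<Longrightarrow> m' \<in> F \<Longrightarrow> (\<And>i. i \<in> J \<Longrightarrow> e m i = e m' i) \<Longrightarrow> m = m'"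
    and "finite S" "infinite T" "\<And>i. i \<in> J \<Longrightarrow> c i \<noteq> 0"
  shows "\<exists>t. (\<forall>i. t i \<in> T) \<and>
    (\<forall>s\<in>S. (\<Sum>m\<in>F. a m * (\<Prod>i\<in>J. (s i + c i * t i) ^ e m i)) \<noteq> 0)"
  using assms(1-5,8)
proof (induction J arbitrary: F rule: finite_induct)
  case empty
  \<comment> \<open>Without variables, distinctness of the exponents leaves a single
    monomial.\<close>
  then obtain m where "F = {m}" by fastforce
  moreover obtain x where "x \<in> T" using \<open>infinite T\<close> by fastforce
  ultimately show ?case using empty by (intro exI[of _ "\<lambda>_. x"]) auto
next
  case (insert j J)
  obtain m0 where m0: "m0 \<in> F" using insert.prems by auto
  define F0 where "F0 = {m \<in> F. e m j = e m0 j}"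
  have "\<exists>t. (\<forall>i. t i \<in> T) \<and>
      (\<forall>s\<in>S. (\<Sum>m\<in>F0. a m * (\<Prod>i\<in>J. (s i + c i * t i) ^ e m i)) \<noteq> 0)"
  proof (rule insert.IH)
    show "finite F0" "F0 \<noteq> {}" using insert.prems m0 by (auto simp: F0_def)
    show "m = m'" if "m \<in> F0" "m' \<in> F0" "\<And>i. i \<in> J \<Longrightarrow> e m i = e m' i" for m m'
      using that by (intro insert.prems(4)) (auto simp: F0_def)
  qed (use insert.prems in \<open>auto simp: F0_def\<close>)
  then obtain t where t: "\<And>i. t i \<in> T"
    "\<And>s. s \<in> S \<Longrightarrow> (\<Sum>m\<in>F0. a m * (\<Prod>i\<in>J. (s i + c i * t i) ^ e m i)) \<noteq> 0"
    by auto
  \<comment> \<open>\<open>Q s\<close> is a polynomial in \<open>s j + c j * x\<close>, the other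
    variables being fixed by \<open>t\<close>; the terms in \<open>F0\<close> make up its
    coefficient of degree \<open>e m0 j\<close>.\<close>
  define Q where "Q s = (\<Sum>m\<in>F. monom (a m * (\<Prod>i\<in>J. (s i + c i * t i) ^ e m i)) (e m j))" for s
  have "finite {x. poly (Q s) (s j + c j * x) = 0}" if "s \<in> S" for s
  proof -
    have "coeff (Q s) (e m0 j) = (\<Sum>m\<in>F0. a m * (\<Prod>i\<in>J. (s i + c i * t i) ^ e m i))"
      unfolding Q_def F0_def using insert.prems(1)
      by (simp add: coeff_sum sum.inter_filter)
    then have "Q s \<noteq> 0" using t(2)[OF that] by auto
    then have "finite {y. poly (Q s) y = 0}" by (rule poly_roots_finite)
    moreover have "inj (\<lambda>x. s j + c j * x)" using insert.prems(5) by (auto simp: inj_def)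
    ultimately have "finite ((\<lambda>x. s j + c j * x) -` {y. poly (Q s) y = 0})"
      by (rule finite_vimageI)
    then show ?thesis by (simp add: vimage_def)
  qed
  then have "finite (\<Union>s\<in>S. {x. poly (Q s) (s j + c j * x) = 0})" using \<open>finite S\<close> by blast
  then obtain x where x: "x \<in> T" "\<And>s. s \<in> S \<Longrightarrow> poly (Q s) (s j + c j * x) \<noteq> 0"
    using \<open>infinite T\<close> by (smt (verit, best) UN_I finite_subset mem_Collect_eq subsetI)
  have "(\<Sum>m\<in>F. a m * (\<Prod>i\<in>insert j J. (s i + c i * (t(j := x)) i) ^ e m i))
      = poly (Q s) (s j + c j * x)" for s
  proof -
    have "(\<Prod>i\<in>insert j J. (s i + c i * (t(j := x)) i) ^ e m i) =
        (\<Prod>i\<in>J. (s i + c i * t i) ^ e m i) * (s j + c j * x) ^ e m j" for m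
    proof -
      have "(\<Prod>i\<in>J. (s i + c i * (t(j := x)) i) ^ e m i) = (\<Prod>i\<in>J. (s i + c i * t i) ^ e m i)"
        using insert.hyps by (intro prod.cong) auto
      then show ?thesis using insert.hyps by (simp add: mult.commute)
    qed
    then show ?thesis by (simp add: Q_def poly_sum poly_monom mult.assoc)
  qed
  then show ?case using x t(1) by (intro exI[of _ "t(j := x)"]) auto
qed

section \<open>An independent family of sequences\<close>

text \<open>A list rather than a set, so that tables keyed by these traces can be encoded as natural
  numbers.\<close>

definition initial_segment :: "nat set \<Rightarrow> nat \<Rightarrow> nat list" where
  "initial_segment A l = filter (\<lambda>i. i \<in> A) [0..<l]"

lemma initial_segments_distinct:
  assumes "finite \<A>"
  obtains l where "inj_on (\<lambda>A. initial_segment A l) \<A>"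
proof -
  \<comment> \<open>\<open>w A B\<close> is a point telling \<open>A\<close> and \<open>B\<close>
    apart; any \<open>l\<close> above these finitely many points separates all traces.\<close>
  obtain w :: "nat set \<Rightarrow> nat set \<Rightarrow> nat" where w: "\<And>A B. A \<noteq> B \<Longrightarrow> w A B \<in> A \<longleftrightarrow> w A B \<notin> B"
    by (metis set_eqI)
  have "finite ((\<lambda>(A, B). w A B) ` (\<A> \<times> \<A>))" using assms by simp
  then obtain l where "\<And>A B. A \<in> \<A> \<Longrightarrow> B \<in> \<A> \<Longrightarrow> w A B < l"
    by (force simp: finite_nat_set_iff_bounded)
  moreover have "i \<in> A \<longleftrightarrow> i \<in> B" if "initial_segment A l = initial_segment B l" "i < l" for A B i
    using arg_cong[OF that(1), of set] that(2) by (auto simp: initial_segment_def)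
  ultimately have "inj_on (\<lambda>A. initial_segment A l) \<A>"
    using w by (metis (no_types, lifting) inj_onI)
  then show thesis by (rule that)
qed

text \<open>
  A place encodes a length \<open>l\<close>, a finite table assigning values to the initial segments of
  length \<open>l\<close>, and an unused number, which makes every table occur at infinitely many places.
\<close>

definition table_value :: "nat set \<Rightarrow> nat \<Rightarrow> nat" where
  "table_value A n =
    (case from_nat n :: nat \<times> (nat list \<times> nat) list \<times> nat of
      (l, tab, r) \<Rightarrow> (case map_of tab (initial_segment A l) of None \<Rightarrow> 0 | Some v \<Rightarrow> v))"

lemma infinite_prescribed_table_values:
  assumes "finite J" "inj_on \<phi> J"
  shows "infinite {n. \<forall>i\<in>J. table_value (\<phi> i) n = t i}"
proof -
  obtain l where "inj_on (\<lambda>A. initial_segment A l) (\<phi> ` J)"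
    using initial_segments_distinct[OF finite_imageI[OF assms(1)]] by blast
  then have inj: "inj_on (\<lambda>i. initial_segment (\<phi> i) l) J"
    using assms(2) comp_inj_on[of \<phi> J] by (simp add: comp_def)
  obtain L where L: "set L = J" "distinct L" using assms(1) finite_distinct_list by blast
  \<comment> \<open>Injectivity on \<open>J\<close> makes the keys distinct, so each lookup returns
    \<open>t i\<close>.\<close>
  define tab where "tab = map (\<lambda>i. (initial_segment (\<phi> i) l, t i)) L"
  have "map_of tab (initial_segment (\<phi> i) l) = Some (t i)" if "i \<in> J" for i
    using that inj L by (intro map_of_is_SomeI) (auto simp: tab_def comp_def distinct_map)
  then have "range (\<lambda>r. to_nat (l, tab, r :: nat)) \<subseteq> {n. \<forall>i\<in>J. table_value (\<phi> i) n = t i}"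
    by (auto simp: table_value_def)
  moreover have "inj (\<lambda>r. to_nat (l, tab, r :: nat))" by (auto simp: inj_def)
  ultimately show ?thesis using finite_subset range_inj_infinite by blast
qed

text \<open>Reciprocals make the unbounded table values bounded and still leave infinitely many
  values, as the grid argument requires.\<close>

definition indep_seq :: "nat set \<Rightarrow> ell_infinity" where
  "indep_seq A = Bcontfun (\<lambda>n. 1 / (real (table_value A n) + 1))"

lemma apply_indep_seq [simp]:
  "apply_bcontfun (indep_seq A) n = 1 / (real (table_value A n) + 1)"
proof -
  have "(\<lambda>n. 1 / (real (table_value A n) + 1)) \<in> bcontfun"
    by (rule bcontfun_normI[of _ 1]) auto
  then show ?thesis by (simp add: indep_seq_def Bcontfun_inverse)
qed

lemma norm_indep_seq_le: "norm (indep_seq A) \<le> 1"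
  by (rule norm_bound) simp

section \<open>Bounded sequences\<close>

lemma apply_bcontfun_sum:
  fixes f :: "'i \<Rightarrow> 'a::topological_space \<Rightarrow>\<^sub>C 'b::real_normed_vector"
  shows "apply_bcontfun (\<Sum>i\<in>I. f i) x = (\<Sum>i\<in>I. apply_bcontfun (f i) x)"
  by (induction I rule: infinite_finite_induct) auto

lemma apply_bcontfun_power:
  fixes f :: "'a::topological_space \<Rightarrow>\<^sub>C 'b::real_normed_algebra_1"
  shows "apply_bcontfun (f ^ k) x = apply_bcontfun f x ^ k"
  by (induction k) auto

lemma apply_bcontfun_prod:
  fixes f :: "'i \<Rightarrow> 'a::topological_space \<Rightarrow>\<^sub>C 'b::{real_normed_algebra_1, comm_ring_1}"
  shows "apply_bcontfun (\<Prod>i\<in>I. f i) x = (\<Prod>i\<in>I. apply_bcontfun (f i) x)"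
  by (induction I rule: infinite_finite_induct) auto

text \<open>The terms of a summable series tend to zero, so the entries would eventually be smaller
  than \<open>\<delta>\<close>.\<close>

lemma not_in_ell_p_if_frequently_large:
  assumes "0 < p" "0 < \<delta>" "infinite {n. \<delta> \<le> \<bar>x n\<bar>}"
  shows "x \<notin> ell_p p"
proof
  assume "x \<in> ell_p p"
  then have "(\<lambda>n. \<bar>x n\<bar> powr p) \<longlonglongrightarrow> 0"
    by (auto simp: ell_p_def summable_LIMSEQ_zero)
  then have "\<forall>\<^sub>F n in sequentially. \<bar>x n\<bar> powr p < \<delta> powr p"
    using assms by (intro order_tendstoD) auto
  then have "\<forall>\<^sub>F n in sequentially. \<bar>x n\<bar> < \<delta>"
    by eventually_elim (meson assms(1,2) linorder_not_le powr_mono2 less_imp_le)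
  then show False
    using assms(3) by (auto simp: eventually_sequentially infinite_nat_iff_unbounded_le not_less[symmetric])
qed

section \<open>Finite-valued sequences: density and enumeration\<close>

text \<open>Finitely many such sequences jointly attain only finitely many vectors, which later
  yields a lower bound uniform over all places.\<close>

definition finite_valued :: "ell_infinity set" where
  "finite_valued = {d. finite (range (apply_bcontfun d))}"

text \<open>Each entry is rounded down to a multiple of \<open>1 / (real m + 1)\<close>; boundedness
  leaves only finitely many multiples.\<close>

lemma finite_valued_approximation:
  fixes x :: ell_infinity and m :: nat
  obtains d where "d \<in> finite_valued" "norm (d - x) \<le> 1 / (real m + 1)"
proof -
  define k where "k n = \<lfloor>apply_bcontfun x n * (real m + 1)\<rfloor>" for n
  define b where "b = \<lceil>norm x * (real m + 1)\<rceil> + 1"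
  have k: "k n \<in> {-b..b}" for n
  proof -
    have "\<bar>apply_bcontfun x n\<bar> * (real m + 1) \<le> norm x * (real m + 1)"
      using norm_bounded[of x n] by (intro mult_right_mono) auto
    then have "\<bar>apply_bcontfun x n * (real m + 1)\<bar> \<le> norm x * (real m + 1)"
      by (simp add: abs_mult)
    then show ?thesis unfolding k_def b_def atLeastAtMost_iff by linarith
  qed
  then have "range k \<subseteq> {-b..b}" by blast
  then have "finite (range k)" by (rule finite_subset) simp
  then have fin: "finite (range (\<lambda>n. of_int (k n) / (real m + 1)))"
    using finite_imageI[of "range k" "\<lambda>i. of_int i / (real m + 1)"] by (simp add: image_image)
  then have cont: "(\<lambda>n. of_int (k n) / (real m + 1)) \<in> bcontfun"
    by (simp add: bcontfun_nat_iff finite_imp_bounded)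
  show thesis
  proof
    show "Bcontfun (\<lambda>n. of_int (k n) / (real m + 1)) \<in> finite_valued"
      using fin by (simp add: finite_valued_def Bcontfun_inverse cont)
    show "norm (Bcontfun (\<lambda>n. of_int (k n) / (real m + 1)) - x) \<le> 1 / (real m + 1)"
    proof (rule norm_bound)
      fix n
      have "of_int (k n) / (real m + 1) - apply_bcontfun x n
          = (of_int (k n) - apply_bcontfun x n * (real m + 1)) / (real m + 1)"
        by (simp add: field_simps)
      moreover have "\<bar>of_int (k n) - apply_bcontfun x n * (real m + 1)\<bar> \<le> 1"
        unfolding k_def by linarith
      ultimately show "norm (apply_bcontfun (Bcontfun (\<lambda>n. of_int (k n) / (real m + 1)) - x) n)
          \<le> 1 / (real m + 1)"
        by (simp add: Bcontfun_inverse cont abs_divide divide_right_mono)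
    qed
  qed
qed

text \<open>A sequence is determined by the rationals below its entries; tagging every pair of a
  position and such a rational with \<open>m\<close> records both components in a subset of a
  countable set.\<close>

lemma ell_infinity_times_nat_lepoll_nat_sets:
  "(UNIV :: (ell_infinity \<times> nat) set) \<lesssim> (UNIV :: nat set set)"
proof -
  define f :: "ell_infinity \<times> nat \<Rightarrow> nat set" where
    "f = (\<lambda>(x, m). to_nat ` {(m, n, q :: rat) | n q. of_rat q < apply_bcontfun x n})"
  have "x = y \<and> m = k" if "f (x, m) = f (y, k)" for x y m k
  proof -
    have eq: "{(m, n, q :: rat) | n q. of_rat q < apply_bcontfun x n}
        = {(k, n, q) | n q. of_rat q < apply_bcontfun y n}"
      using that by (simp add: f_def inj_image_eq_iff)
    \<comment> \<open>Some rational lies below entry 0, so the encoded set is non-empty and its tag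
      can be read off.\<close>
    obtain q where "of_rat q < apply_bcontfun x 0"
      using of_rat_dense[of "apply_bcontfun x 0 - 1" "apply_bcontfun x 0"] by auto
    then have "(m, 0, q) \<in> {(m, n, q :: rat) | n q. of_rat q < apply_bcontfun x n}" by simp
    then have "m = k" unfolding eq by simp
    have iff: "of_rat q < apply_bcontfun x n \<longleftrightarrow> of_rat q < apply_bcontfun y n" for q n
      using eq[THEN eqset_imp_iff, of "(k, n, q)"] \<open>m = k\<close> by simp
    have "apply_bcontfun x n = apply_bcontfun y n" for n
      by (metis iff less_asym linorder_less_linear of_rat_dense)
    then show ?thesis using \<open>m = k\<close> by (simp add: bcontfun_eqI)
  qed
  then have "inj f" by (auto simp: inj_def)
  then show ?thesis unfolding lepoll_def by blast
qed

text \<open>Every finite-valued sequence is paired with every \<open>m\<close>, so that it has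
  arbitrarily small perturbations among the generators.\<close>

lemma enumerate_finite_valued:
  obtains d :: "nat set \<Rightarrow> ell_infinity" and c :: "nat set \<Rightarrow> nat"
  where "\<And>A. d A \<in> finite_valued" "\<And>x m. x \<in> finite_valued \<Longrightarrow> \<exists>A. d A = x \<and> c A = m"
proof -
  have "finite_valued \<times> (UNIV :: nat set) \<lesssim> (UNIV :: nat set set)"
    by (rule lepoll_trans[OF subset_imp_lepoll[OF subset_UNIV] ell_infinity_times_nat_lepoll_nat_sets])
  then obtain D :: "nat set \<Rightarrow> ell_infinity \<times> nat" where D: "finite_valued \<times> UNIV \<subseteq> range D"
    unfolding lepoll_iff by blast
  have zero: "0 \<in> finite_valued" by (simp add: finite_valued_def)
  show thesis
  proof
    \<comment> \<open>Indices whose first component under \<open>D\<close> is not finite-valued get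
      the default 0.\<close>
    show "(if fst (D A) \<in> finite_valued then fst (D A) else 0) \<in> finite_valued" for A
      using zero by simp
    show "\<exists>A. (if fst (D A) \<in> finite_valued then fst (D A) else 0) = x \<and> (snd \<circ> D) A = m"
      if "x \<in> finite_valued" for x m
    proof -
      have "(x, m) \<in> range D" using that D by blast
      then obtain A where "D A = (x, m)" by fastforce
      then show ?thesis using that by (intro exI[of _ A]) simp
    qed
  qed
qed

section \<open>The perturbed generators\<close>

text \<open>Exponents are functions on a finite index set \<open>J\<close>, so that linear
  combinations, polynomials and multiset monomials are all instances.\<close>

lemma polynomial_in_perturbations_not_in_ell_p:
  fixes d g :: "nat set \<Rightarrow> ell_infinity" and c :: "nat set \<Rightarrow> nat"
    and e :: "'m \<Rightarrow> 'j \<Rightarrow> nat" and a :: "'m \<Rightarrow> real" and \<phi> :: "'j \<Rightarrow> nat set"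
  assumes "0 < p" "\<And>A. d A \<in> finite_valued"
    and g: "\<And>A. g A = d A + (1 / (real (c A) + 1)) *\<^sub>R indep_seq A"
    and "finite J" "inj_on \<phi> J" "finite F" "F \<noteq> {}" "\<And>m. m \<in> F \<Longrightarrow> a m \<noteq> 0"
    and "\<And>m m'. m \<in> F \<Longrightarrow> m' \<in> F \<Longrightarrow> (\<And>i. i \<in> J \<Longrightarrow> e m i = e m' i) \<Longrightarrow> m = m'"
  shows "apply_bcontfun (\<Sum>m\<in>F. a m *\<^sub>R (\<Prod>i\<in>J. g (\<phi> i) ^ e m i)) \<notin> ell_p p"
proof -
  \<comment> \<open>The default 0 outside \<open>J\<close> confines all the vectors
    \<open>s n\<close> to a finite set of functions.\<close>
  define s where "s n = (\<lambda>i. if i \<in> J then apply_bcontfun (d (\<phi> i)) n else 0)" for n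
  define T where "T = range (\<lambda>v. 1 / (real v + 1))"
  define val where "val s t =
    (\<Sum>m\<in>F. a m * (\<Prod>i\<in>J. (s i + (1 / (real (c (\<phi> i)) + 1)) * t i) ^ e m i))" for s t
  have "finite (range s)"
  proof (rule finite_subset)
    show "range s \<subseteq> {f. (\<forall>i. (i \<in> J \<longrightarrow> f i \<in> (\<Union>i\<in>J. range (apply_bcontfun (d (\<phi> i)))))
        \<and> (i \<notin> J \<longrightarrow> f i = 0))}"
      by (fastforce simp: s_def)
    show "finite \<dots>"
      using assms(2,4) by (intro finite_set_of_finite_funs) (auto simp: finite_valued_def)
  qed
  moreover have "infinite T"
    unfolding T_def by (rule range_inj_infinite) (auto simp: inj_def)
  ultimately have "\<exists>t. (\<forall>i. t i \<in> T) \<and> (\<forall>r\<in>range s. val r t \<noteq> 0)"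
    unfolding val_def using assms(4,6-9) by (intro exists_grid_point_nonzero) simp_all
  then obtain t where t: "\<And>i. t i \<in> T" "\<And>n. val (s n) t \<noteq> 0"
    by blast
  obtain v where v: "\<And>i. t i = 1 / (real (v i) + 1)"
    using t(1) unfolding T_def image_iff by metis
  \<comment> \<open>A minimum over the finitely many shifts, positive because the one grid point
    \<open>t\<close> serves them all.\<close>
  define \<delta> where "\<delta> = Min ((\<lambda>s. \<bar>val s t\<bar>) ` range s)"
  have \<delta>: "\<delta> \<le> \<bar>val (s n) t\<bar>" for n
    unfolding \<delta>_def using \<open>finite (range s)\<close> by (intro Min_le) auto
  have "\<delta> \<in> (\<lambda>s. \<bar>val s t\<bar>) ` range s"
    unfolding \<delta>_def using \<open>finite (range s)\<close> by (intro Min_in) auto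
  then have "0 < \<delta>" using t(2) by auto
  let ?y = "apply_bcontfun (\<Sum>m\<in>F. a m *\<^sub>R (\<Prod>i\<in>J. g (\<phi> i) ^ e m i))"
  \<comment> \<open>At these places the independent sequences take exactly the values
    \<open>t i\<close>, whatever the shift \<open>s n\<close> is there.\<close>
  have "?y n = val (s n) t" if "\<forall>i\<in>J. table_value (\<phi> i) n = v i" for n
    using that unfolding val_def
    by (auto simp: apply_bcontfun_sum apply_bcontfun_prod apply_bcontfun_power g s_def v
        intro!: sum.cong prod.cong)
  then have "{n. \<forall>i\<in>J. table_value (\<phi> i) n = v i} \<subseteq> {n. \<delta> \<le> \<bar>?y n\<bar>}"
    using \<delta> by auto
  then have "infinite {n. \<delta> \<le> \<bar>?y n\<bar>}"
    using infinite_prescribed_table_values[OF assms(4,5)] finite_subset by blast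
  then show ?thesis using not_in_ell_p_if_frequently_large \<open>0 < p\<close> \<open>0 < \<delta>\<close> by blast
qed

text \<open>Multisets of indices serve as monomials: if factors repeat in a product, their
  multiplicities add up.\<close>

lemma generated_algebra_memE:
  fixes g :: "'i \<Rightarrow> 'a::{real_normed_algebra_1, comm_ring_1}"
  assumes "y \<in> generated_algebra (range g)"
  obtains F :: "'i multiset set" and a
  where "finite F" "\<And>M. M \<in> F \<Longrightarrow> a M \<noteq> 0"
    and "y = (\<Sum>M\<in>F. a M *\<^sub>R prod_mset (image_mset g M))"
proof -
  let ?P = "\<lambda>M. prod_mset (image_mset g M)"
  have "{\<Prod>i<k. h i ^ n i | (k::nat) h (n :: nat \<Rightarrow> nat). k \<ge> 1 \<and> (\<forall>i<k. h i \<in> range g \<and> n i \<ge> 1)} \<subseteq> range ?P"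
  proof safe
    fix k :: nat and h and n :: "nat \<Rightarrow> nat"
    assume "\<forall>i<k. h i \<in> range g \<and> 1 \<le> n i"
    then obtain \<phi> where \<phi>: "\<And>i. i < k \<Longrightarrow> h i = g (\<phi> i)"
      using that[of "\<lambda>i. inv g (h i)"] by (simp add: f_inv_into_f)
    have "?P (\<Sum>i<l. replicate_mset (n i) (\<phi> i)) = (\<Prod>i<l. g (\<phi> i) ^ n i)" for l
      by (induction l) (auto simp: mult.commute)
    then show "(\<Prod>i<k. h i ^ n i) \<in> range ?P"
      using \<phi> by (intro range_eqI[of _ _ "\<Sum>i<k. replicate_mset (n i) (\<phi> i)"]) simp
  qed
  then have "y \<in> span (range ?P)"
    using assms span_mono unfolding generated_algebra_def by blast
  then obtain V r where V: "finite V" "V \<subseteq> range ?P" "y = (\<Sum>v\<in>V. r v *\<^sub>R v)"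
    by (auto simp: span_explicit)
  \<comment> \<open>One multiset is chosen for each vector in \<open>V\<close>, so the coefficients
    carry over without collisions.\<close>
  then obtain U where U: "inj_on ?P U" "V = ?P ` U" unfolding subset_image_inj by blast
  then have "finite U" using V(1) finite_imageD by blast
  show thesis
  proof (rule that)
    show "finite {M \<in> U. r (?P M) \<noteq> 0}" using \<open>finite U\<close> by simp
    show "y = (\<Sum>M\<in>{M \<in> U. r (?P M) \<noteq> 0}. r (?P M) *\<^sub>R ?P M)"
      using V(3) U \<open>finite U\<close> by (auto simp: sum.reindex intro!: sum.mono_neutral_right)
  qed auto
qed

lemma generators_subset_generated_algebra: "G \<subseteq> generated_algebra G"
proof
  fix x assume "x \<in> G"
  then show "x \<in> generated_algebra G"
    unfolding generated_algebra_def
    by (intro span_base CollectI exI[of _ 1] exI[of _ "\<lambda>_. x"] exI[of _ "\<lambda>_. 1"]) simp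
qed

section \<open>Construction of the generators\<close>

lemma exists_generators_avoiding_ell_p:
  assumes "0 < p"
  obtains G :: "ell_infinity set"
  where "G \<approx> (UNIV :: real set)" "independent G" "algebraically_independent G"
    "closure (generated_algebra G) = UNIV"
    "\<And>y. y \<in> generated_algebra G \<Longrightarrow> y \<noteq> 0 \<Longrightarrow> apply_bcontfun y \<notin> ell_p p"
proof -
  obtain d :: "nat set \<Rightarrow> ell_infinity" and c :: "nat set \<Rightarrow> nat" where
    d: "\<And>A. d A \<in> finite_valued" and dc: "\<And>x m. x \<in> finite_valued \<Longrightarrow> \<exists>A. d A = x \<and> c A = m"
    using enumerate_finite_valued by blast
  define g where "g A = d A + (1 / (real (c A) + 1)) *\<^sub>R indep_seq A" for A
  note key = polynomial_in_perturbations_not_in_ell_p[OF assms d g_def]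
  \<comment> \<open>Hence whatever lies outside \<open>ell_p p\<close> is non-zero, which turns
    \<open>key\<close> into independence statements.\<close>
  have zero: "apply_bcontfun 0 \<in> ell_p p" by (simp add: ell_p_def)
  have linear: "apply_bcontfun (\<Sum>A\<in>F. a A *\<^sub>R g A) \<notin> ell_p p"
    if "finite F" "F \<noteq> {}" "\<And>A. A \<in> F \<Longrightarrow> a A \<noteq> 0" for F a
  proof -
    \<comment> \<open>Indicator functions as exponents turn the monomials into single
      generators.\<close>
    have "(\<Prod>i\<in>F. g i ^ (if i = A then 1 else 0)) = g A" if "A \<in> F" for A
    proof -
      have "(\<Prod>i\<in>F. g i ^ (if i = A then 1 else 0)) = (\<Prod>i\<in>F. if i = A then g i else 1)"
        by (intro prod.cong) auto
      then show ?thesis using that \<open>finite F\<close> by simp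
    qed
    then have "(\<Sum>A\<in>F. a A *\<^sub>R g A) = (\<Sum>A\<in>F. a A *\<^sub>R (\<Prod>i\<in>F. g i ^ (if i = A then 1 else 0)))"
      by simp
    moreover have "apply_bcontfun (\<Sum>A\<in>F. a A *\<^sub>R (\<Prod>i\<in>F. g (id i) ^ (if i = A then 1 else 0))) \<notin> ell_p p"
    proof (rule key)
      show "A = B" if "A \<in> F" "\<And>i. i \<in> F \<Longrightarrow> (if i = A then 1 else 0 :: nat) = (if i = B then 1 else 0)"
        for A B
        using that(2)[OF that(1)] by (simp split: if_splits)
    qed (use that in auto)
    ultimately show ?thesis by simp
  qed
  have "inj g"
  proof (rule injI, rule ccontr)
    fix A B assume "g A = g B" "A \<noteq> B"
    then have "(\<Sum>C\<in>{A, B}. (if C = A then 1 else - 1) *\<^sub>R g C) = 0" by simp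
    then show False using linear[of "{A, B}" "\<lambda>C. if C = A then 1 else - 1"] zero by auto
  qed
  show thesis
  proof
    show "range g \<approx> (UNIV :: real set)"
      using \<open>inj g\<close> nat_sets_eqpoll_reals eqpoll_trans inj_on_image_eqpoll_self by blast
    show "independent (range g)"
    proof
      assume "dependent (range g)"
      then obtain V u where V: "finite V" "V \<subseteq> range g" "(\<Sum>v\<in>V. u v *\<^sub>R v) = 0" "\<exists>v\<in>V. u v \<noteq> 0"
        by (auto simp: dependent_explicit)
      then obtain U where U: "V = g ` U" "finite U" by (meson finite_subset_image)
      \<comment> \<open>Zero coefficients are discarded, since \<open>linear\<close> asks for
        non-zero ones.\<close>
      define U' where "U' = {A \<in> U. u (g A) \<noteq> 0}"
      have "(\<Sum>v\<in>V. u v *\<^sub>R v) = (\<Sum>A\<in>U. u (g A) *\<^sub>R g A)"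
        using \<open>inj g\<close> U by (simp add: sum.reindex inj_on_subset[OF \<open>inj g\<close>])
      also have "\<dots> = (\<Sum>A\<in>U'. u (g A) *\<^sub>R g A)"
        using U by (auto simp: U'_def intro!: sum.mono_neutral_right)
      finally have "(\<Sum>A\<in>U'. u (g A) *\<^sub>R g A) = 0" using V(3) by simp
      moreover have "finite U'" "U' \<noteq> {}" using U V(4) by (auto simp: U'_def)
      moreover have "apply_bcontfun (\<Sum>A\<in>U'. u (g A) *\<^sub>R g A) \<notin> ell_p p" if "finite U'" "U' \<noteq> {}"
        using that by (rule linear) (simp add: U'_def)
      ultimately show False using zero by simp
    qed
    show "algebraically_independent (range g)"
      unfolding algebraically_independent_def
    proof (intro allI impI notI)
      fix k :: nat and P f
      assume P: "P \<noteq> 0" "mpoly_vars P \<subseteq> {..<k}" and f: "f ` {..<k} \<subseteq> range g" "inj_on f {..<k}"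
        and eval: "mpoly_eval P f = 0"
      obtain \<phi> where \<phi>: "\<And>i. i < k \<Longrightarrow> f i = g (\<phi> i)"
        using that[of "\<lambda>i. inv g (f i)"] f(1) by (simp add: f_inv_into_f image_subset_iff)
      then have inj: "inj_on \<phi> {..<k}" using f(2) by (auto simp: inj_on_def)
      have vars: "Poly_Mapping.keys m \<subseteq> {..<k}" if "m \<in> Poly_Mapping.keys P" for m
        using P(2) that by (auto simp: mpoly_vars_def)
      \<comment> \<open>Variables absent from a monomial get exponent 0, which puts all monomials
        over the common index set \<open>{..<k}\<close>.\<close>
      have "mpoly_eval P f = (\<Sum>m\<in>Poly_Mapping.keys P. Poly_Mapping.lookup P m *\<^sub>R
          (\<Prod>i<k. g (\<phi> i) ^ Poly_Mapping.lookup m i))"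
        unfolding mpoly_eval_def
      proof (intro sum.cong refl arg_cong2[of _ _ _ _ scaleR])
        fix m assume "m \<in> Poly_Mapping.keys P"
        then show "(\<Prod>i\<in>Poly_Mapping.keys m. f i ^ Poly_Mapping.lookup m i)
            = (\<Prod>i<k. g (\<phi> i) ^ Poly_Mapping.lookup m i)"
          using vars[of m] \<phi> by (intro prod.mono_neutral_cong_left) (auto simp: in_keys_iff subset_iff)
      qed
      moreover have "apply_bcontfun (\<Sum>m\<in>Poly_Mapping.keys P. Poly_Mapping.lookup P m *\<^sub>R
          (\<Prod>i<k. g (\<phi> i) ^ Poly_Mapping.lookup m i)) \<notin> ell_p p"
      proof (rule key)
        show "m = m'" if m: "m \<in> Poly_Mapping.keys P" "m' \<in> Poly_Mapping.keys P"
          and eq: "\<And>i. i \<in> {..<k} \<Longrightarrow> Poly_Mapping.lookup m i = Poly_Mapping.lookup m' i" for m m'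
        proof (rule poly_mapping_eqI)
          fix i
          show "Poly_Mapping.lookup m i = Poly_Mapping.lookup m' i"
            using eq[of i] vars[OF m(1)] vars[OF m(2)] by (metis in_keys_iff subsetD)
        qed
      qed (use P inj in \<open>auto simp: in_keys_iff\<close>)
      ultimately show False using eval zero by simp
    qed
    show "closure (generated_algebra (range g)) = UNIV"
    proof -
      have "x \<in> closure (range g)" for x
        unfolding closure_approachable
      proof (intro allI impI)
        fix \<epsilon> :: real assume "0 < \<epsilon>"
        \<comment> \<open>One half of \<open>\<epsilon>\<close> is for the rounding error, the other
          for the perturbation.\<close>
        then obtain m where m: "1 / (real m + 1) < \<epsilon> / 2"
          using reals_Archimedean[of "\<epsilon> / 2"] by (auto simp: field_simps)
        obtain y where y: "y \<in> finite_valued" "norm (y - x) \<le> 1 / (real m + 1)"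
          using finite_valued_approximation by blast
        then obtain A where "d A = y" "c A = m" using dc by blast
        then have "g A - x = (y - x) + (1 / (real m + 1)) *\<^sub>R indep_seq A" by (simp add: g_def)
        then have "norm (g A - x) \<le> norm (y - x) + norm ((1 / (real m + 1)) *\<^sub>R indep_seq A)"
          by (metis norm_triangle_ineq)
        also have "norm ((1 / (real m + 1)) *\<^sub>R indep_seq A) \<le> 1 / (real m + 1)"
          using norm_indep_seq_le[of A] by (simp add: divide_right_mono)
        finally have "dist (g A) x < \<epsilon>" using y(2) m by (simp add: dist_norm)
        then show "\<exists>z\<in>range g. dist z x < \<epsilon>" by blast
      qed
      then show ?thesis
        using closure_mono[OF generators_subset_generated_algebra[of "range g"]] by blast
    qed
    show "apply_bcontfun y \<notin> ell_p p" if "y \<in> generated_algebra (range g)" "y \<noteq> 0" for y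
    proof -
      obtain F a where F: "finite F" "\<And>M. M \<in> F \<Longrightarrow> a M \<noteq> 0"
        and y: "y = (\<Sum>M\<in>F. a M *\<^sub>R prod_mset (image_mset g M))"
        using generated_algebra_memE[OF \<open>y \<in> generated_algebra (range g)\<close>] by blast
      define J where "J = (\<Union>M\<in>F. set_mset M)"
      have "finite J" using F(1) by (simp add: J_def)
      have "prod_mset (image_mset g M) = (\<Prod>i\<in>J. g (id i) ^ count M i)" if "M \<in> F" for M
        unfolding image_prod_mset_multiplicity using that \<open>finite J\<close>
        by (intro prod.mono_neutral_cong_left) (auto simp: J_def not_in_iff)
      then have "y = (\<Sum>M\<in>F. a M *\<^sub>R (\<Prod>i\<in>J. g (id i) ^ count M i))" using y by simp
      moreover have "apply_bcontfun \<dots> \<notin> ell_p p"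
      proof (rule key)
        show "F \<noteq> {}" using y \<open>y \<noteq> 0\<close> by auto
        show "M = M'" if M: "M \<in> F" "M' \<in> F" and eq: "\<And>i. i \<in> J \<Longrightarrow> count M i = count M' i" for M M'
        proof (rule multiset_eqI)
          fix i
          show "count M i = count M' i"
            using M eq[of i] by (cases "i \<in> J") (auto simp: J_def not_in_iff)
        qed
      qed (use F \<open>finite J\<close> in auto)
      ultimately show ?thesis by simp
    qed
  qed
qed

section \<open>Cardinality of Hamel bases\<close>

text \<open>Extending \<open>G\<close> to a basis gives at least continuum many elements; the whole
  space has no more than that. This applies both to the generated algebra and to the full
  space.\<close>

lemma hamel_basis_eqpoll_reals:
  fixes V :: "ell_infinity set"
  assumes "subspace V" "G \<subseteq> V" "independent G" "G \<approx> (UNIV :: real set)"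
  obtains B where "hamel_basis V B" "B \<approx> (UNIV :: real set)"
proof -
  obtain B where B: "G \<subseteq> B" "B \<subseteq> V" "independent B" "V \<subseteq> span B"
    using maximal_independent_subset_extend[OF assms(2,3)] by blast
  have "span B = V" using B(2,4) assms(1) by (simp add: span_minimal subset_antisym)
  moreover have "B \<lesssim> (UNIV :: real set)"
  proof -
    have "B \<lesssim> (UNIV :: ell_infinity set)" by (simp add: subset_imp_lepoll)
    also have "\<dots> \<lesssim> (UNIV :: (ell_infinity \<times> nat) set)"
      unfolding lepoll_def by (intro exI[of _ "\<lambda>x. (x, 0)"]) (auto simp: inj_def)
    also have "\<dots> \<lesssim> (UNIV :: nat set set)" by (rule ell_infinity_times_nat_lepoll_nat_sets)
    also have "\<dots> \<approx> (UNIV :: real set)" by (rule nat_sets_eqpoll_reals)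
    finally show ?thesis .
  qed
  moreover have "(UNIV :: real set) \<lesssim> B"
    using assms(4) B(1) by (meson eqpoll_sym lepoll_trans1 subset_imp_lepoll)
  ultimately show thesis using that B(3) lepoll_antisym by (auto simp: hamel_basis_def)
qed

theorem corollary1p4:
  fixes p :: real
  assumes "0 < p"
  shows "maximal_dense_lineable ({x :: ell_infinity. apply_bcontfun x \<notin> ell_p p} \<union> {0})
         \<and> densely_strongly_continuum_algebrable
           ({x :: ell_infinity. apply_bcontfun x \<notin> ell_p p} \<union> {0})"
proof -
  obtain G :: "ell_infinity set" where G: "G \<approx> (UNIV :: real set)" "independent G"
    "algebraically_independent G" "closure (generated_algebra G) = UNIV"
    "\<And>y. y \<in> generated_algebra G \<Longrightarrow> y \<noteq> 0 \<Longrightarrow> apply_bcontfun y \<notin> ell_p p"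
    using exists_generators_avoiding_ell_p[OF assms] by blast
  have sub: "subspace (generated_algebra G)" by (simp add: generated_algebra_def)
  obtain B where B: "hamel_basis (generated_algebra G) B" "B \<approx> (UNIV :: real set)"
    using hamel_basis_eqpoll_reals[OF sub generators_subset_generated_algebra G(2,1)] by blast
  obtain C where C: "hamel_basis (UNIV :: ell_infinity set) C" "C \<approx> (UNIV :: real set)"
    using hamel_basis_eqpoll_reals[OF subspace_UNIV subset_UNIV G(2,1)] by blast
  have "same_hamel_dim (generated_algebra G) (UNIV :: ell_infinity set)"
    unfolding same_hamel_dim_def using B C by (meson eqpoll_sym eqpoll_trans)
  then show ?thesis
    unfolding maximal_dense_lineable_def densely_strongly_continuum_algebrable_def
    using G sub by blast
qed

end
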